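(* Let $M$ be an $\mathbb R_+$-contracting space with central point $\omega$, $U$ a neighborhood of $\omega$ in $M$, $b$ a real number and $f:(M,U)\to(\mathbb R_b,\mathbb R)$ an $\mathbb R_+$-contactable centred function (so $f:U\to\mathbb R$ with $f(\omega)=b$). If every closed and bounded subset of $M$ is compact and if the $\mathbb R_+$-contact $\mathrm{K}_{\mathbb R_+}f:M\to\mathbb R_b$ admits a strict global minimum at $\omega$, then $f$ admits a strict local minimum at $\omega$.
   Context: $\mathbb R_+=[0,+\infty[$ is regarded as a multiplicative monoid. An $\mathbb R_+$-contracting space is a metric space $M$ with a central point $\omega\in M$ and an operation $\mathbb R_+\times M\to M$, $(t,x)\mapsto t\star x$, such that $1\star x=x$; $t'\star(t\star x)=(t't)\star x$; $0\star\omega=\omega$; $d(t\star x,t\star y)=t\,d(x,y)$ for all $t,t'\in\mathbb R_+$, $x,y\in M$. A map $h$ between $\mathbb R_+$-contracting spaces is $\mathbb R_+$-homogeneous if $h(t\star x)=t\star h(x)$ for all $t,x$. $\mathbb R_b$ denotes the metric space $\mathbb R$ with central point $\omega=b$ and $t\star y=b+t(y-b)$. Let $M,M'$ be $\mathbb R_+$-contracting spaces and $V,V'$ neighborhoods of $\omega$ in $M,M'$. A centred map $f:(M,V)\to(M',V')$ is a map $f:V\to V'$ with $f(\omega)=\omega$. It is $\mathbb R_+$-contactable if there exists an $\mathbb R_+$-homogeneous Lipschitz map $h:M\to M'$ such that $f$ is tangent to $h|_V$ at $\omega$, i.e. $\forall\varepsilon>0\ \exists\eta>0\ \forall x\in V\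 (d(x,\omega)\le\eta\Rightarrow d(f(x),h(x))\le\varepsilon\,d(x,\omega))$. Such $h$ is unique, is denoted $\mathrm{K}_{\mathbb R_+}f$ and called the $\mathbb R_+$-contact of $f$. *)

theory Defs
  imports "HOL-Analysis.Analysis"
begin

text \<open>The monoid \<open>[0, \<infinity>[\<close> is rendered by real scalars guarded by \<open>0 \<le> t\<close>; the values of
  the operation at negative scalars are irrelevant.\<close>

locale contracting_space =
  fixes star :: "real \<Rightarrow> 'a::metric_space \<Rightarrow> 'a" and \<omega> :: 'a
  assumes star_one: "star 1 x = x"
    and star_assoc: "0 \<le> s \<Longrightarrow> 0 \<le> t \<Longrightarrow> star s (star t x) = star (s * t) x"
    and star_center: "star 0 \<omega> = \<omega>"
    and dist_star: "0 \<le> t \<Longrightarrow> dist (star t x) (star t y) = t * dist x y"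
begin

lemma star_0: "star 0 x = \<omega>"
  using dist_star[of 0 x \<omega>] star_center by simp

lemma star_omega: "0 \<le> t \<Longrightarrow> star t \<omega> = \<omega>"
  using star_assoc[of t 0 \<omega>] star_center by simp

lemma dist_star_omega: "0 \<le> t \<Longrightarrow> dist (star t x) \<omega> = t * dist x \<omega>"
  using dist_star[of t x \<omega>] star_omega by simp

end

definition real_star :: "real \<Rightarrow> real \<Rightarrow> real \<Rightarrow> real"
  where "real_star b t y = b + t * (y - b)"

lemma contracting_space_real: "contracting_space (real_star b) b"
proof
  fix t x y :: real
  assume "0 \<le> t"
  have "real_star b t x - real_star b t y = t * (x - y)"
    by (simp add: real_star_def algebra_simps)
  then show "dist (real_star b t x) (real_star b t y) = t * dist x y"
    using \<open>0 \<le> t\<close> by (simp add: dist_real_def abs_mult)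
qed (simp_all add: real_star_def)

definition neighborhood :: "'a::topological_space \<Rightarrow> 'a set \<Rightarrow> bool"
  where "neighborhood a V \<longleftrightarrow> (\<exists>T. open T \<and> a \<in> T \<and> T \<subseteq> V)"

text \<open>A map defined on \<open>V\<close> is a total function of which only the values on \<open>V\<close> are ever used.\<close>

definition centred_map :: "'a \<Rightarrow> 'a set \<Rightarrow> 'b \<Rightarrow> 'b set \<Rightarrow> ('a \<Rightarrow> 'b) \<Rightarrow> bool"
  where "centred_map \<omega> V \<omega>' V' f \<longleftrightarrow> f \<in> V \<rightarrow> V' \<and> f \<omega> = \<omega>'"

definition homogeneous :: "(real \<Rightarrow> 'a \<Rightarrow> 'a) \<Rightarrow> (real \<Rightarrow> 'b \<Rightarrow> 'b) \<Rightarrow> ('a \<Rightarrow> 'b) \<Rightarrow> bool"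
  where "homogeneous star star' h \<longleftrightarrow> (\<forall>t\<ge>0. \<forall>x. h (star t x) = star' t (h x))"

definition tangent_at ::
    "'a::metric_space \<Rightarrow> 'a set \<Rightarrow> ('a \<Rightarrow> 'b::metric_space) \<Rightarrow> ('a \<Rightarrow> 'b) \<Rightarrow> bool"
  where "tangent_at \<omega> V f h \<longleftrightarrow>
    (\<forall>\<epsilon>>0. \<exists>\<eta>>0. \<forall>x\<in>V. dist x \<omega> \<le> \<eta> \<longrightarrow> dist (f x) (h x) \<le> \<epsilon> * dist x \<omega>)"

definition is_contact ::
    "(real \<Rightarrow> 'a::metric_space \<Rightarrow> 'a) \<Rightarrow> 'a \<Rightarrow> 'a set \<Rightarrow> (real \<Rightarrow> 'b::metric_space \<Rightarrow> 'b)
      \<Rightarrow> ('a \<Rightarrow> 'b) \<Rightarrow> ('a \<Rightarrow> 'b) \<Rightarrow> bool"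
  where "is_contact star \<omega> V star' f h \<longleftrightarrow>
    homogeneous star star' h \<and> (\<exists>C. C-lipschitz_on UNIV h) \<and> tangent_at \<omega> V f h"

definition contactable ::
    "(real \<Rightarrow> 'a::metric_space \<Rightarrow> 'a) \<Rightarrow> 'a \<Rightarrow> 'a set \<Rightarrow> (real \<Rightarrow> 'b::metric_space \<Rightarrow> 'b)
      \<Rightarrow> ('a \<Rightarrow> 'b) \<Rightarrow> bool"
  where "contactable star \<omega> V star' f \<longleftrightarrow> (\<exists>h. is_contact star \<omega> V star' f h)"

definition contact ::
    "(real \<Rightarrow> 'a::metric_space \<Rightarrow> 'a) \<Rightarrow> 'a \<Rightarrow> 'a set \<Rightarrow> (real \<Rightarrow> 'b::metric_space \<Rightarrow> 'b)
      \<Rightarrow> ('a \<Rightarrow> 'b) \<Rightarrow> 'a \<Rightarrow> 'b"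
  where "contact star \<omega> V star' f = (THE h. is_contact star \<omega> V star' f h)"

text \<open>The description operator in \<open>contact\<close> is meaningful: contacts are unique.\<close>

lemma is_contact_unique:
  assumes M: "contracting_space star \<omega>" and M': "contracting_space star' \<omega>'"
    and V: "neighborhood \<omega> V"
    and h: "is_contact star \<omega> V star' f h" and k: "is_contact star \<omega> V star' f k"
  shows "h = k"
proof
  fix x
  interpret M: contracting_space star \<omega> by fact
  interpret M': contracting_space star' \<omega>' by fact
  obtain r where r: "r > 0" "ball \<omega> r \<subseteq> V"
    using V unfolding neighborhood_def by (meson open_contains_ball subset_trans)
  have bound: "dist (h x) (k x) \<le> 2 * \<epsilon> * dist x \<omega>" if "\<epsilon> > 0" for \<epsilon>
  proof -
    obtain \<eta>1 where 1: "\<eta>1 > 0"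
        "\<And>y. y \<in> V \<Longrightarrow> dist y \<omega> \<le> \<eta>1 \<Longrightarrow> dist (f y) (h y) \<le> \<epsilon> * dist y \<omega>"
      using h \<open>\<epsilon> > 0\<close> unfolding is_contact_def tangent_at_def by meson
    obtain \<eta>2 where 2: "\<eta>2 > 0"
        "\<And>y. y \<in> V \<Longrightarrow> dist y \<omega> \<le> \<eta>2 \<Longrightarrow> dist (f y) (k y) \<le> \<epsilon> * dist y \<omega>"
      using k \<open>\<epsilon> > 0\<close> unfolding is_contact_def tangent_at_def by meson
    define m where "m = min (r / 2) (min \<eta>1 \<eta>2)"
    define t where "t = m / (dist x \<omega> + 1)"
    have m: "m > 0" "m < r" "m \<le> \<eta>1" "m \<le> \<eta>2"
      using r 1(1) 2(1) by (auto simp: m_def)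
    have pos: "dist x \<omega> + 1 > 0"
      by (simp add: add_nonneg_pos)
    have t: "t > 0"
      using m pos by (simp add: t_def)
    have "t * dist x \<omega> \<le> t * (dist x \<omega> + 1)"
      using t by simp
    also have "\<dots> = m"
      using pos by (simp add: t_def)
    finally have le: "dist (star t x) \<omega> \<le> m"
      using t by (simp add: M.dist_star_omega)
    have inV: "star t x \<in> V"
      using le m r(2) by (auto simp: dist_commute)
    have "t * dist (h x) (k x) = dist (h (star t x)) (k (star t x))"
      using h k t by (simp add: is_contact_def homogeneous_def M'.dist_star)
    also have "\<dots> \<le> dist (f (star t x)) (h (star t x)) + dist (f (star t x)) (k (star t x))"
      by (rule dist_triangle3)
    also have "\<dots> \<le> 2 * \<epsilon> * dist (star t x) \<omega>"
      using 1(2)[OF inV] 2(2)[OF inV] le m by simp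
    also have "\<dots> = t * (2 * \<epsilon> * dist x \<omega>)"
      using t by (simp add: M.dist_star_omega)
    finally show ?thesis
      using t by simp
  qed
  have "dist (h x) (k x) \<le> 0 + e" if "e > 0" for e
  proof -
    have pos: "dist x \<omega> + 1 > 0"
      by (simp add: add_nonneg_pos)
    define \<epsilon> where "\<epsilon> = e / (2 * (dist x \<omega> + 1))"
    have e: "\<epsilon> > 0"
      using that pos by (simp add: \<epsilon>_def)
    have "2 * \<epsilon> * dist x \<omega> \<le> 2 * \<epsilon> * (dist x \<omega> + 1)"
      using e by simp
    also have "\<dots> = e"
      using pos by (simp add: \<epsilon>_def field_simps)
    finally show ?thesis
      using bound[OF e] by simp
  qed
  then have "dist (h x) (k x) \<le> 0"
    by (rule field_le_epsilon)
  then show "h x = k x"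
    by simp
qed

lemma is_contact_contact:
  assumes "contracting_space star \<omega>" and "contracting_space star' \<omega>'"
    and "neighborhood \<omega> V" and "contactable star \<omega> V star' f"
  shows "is_contact star \<omega> V star' f (contact star \<omega> V star' f)"
proof -
  obtain h where h: "is_contact star \<omega> V star' f h"
    using assms(4) unfolding contactable_def by blast
  show ?thesis
    unfolding contact_def
    by (rule theI[of _ h]) (fact h, rule is_contact_unique[OF assms(1-3) _ h])
qed

definition strict_min_on :: "'a set \<Rightarrow> ('a \<Rightarrow> real) \<Rightarrow> 'a \<Rightarrow> bool"
  where "strict_min_on S g a \<longleftrightarrow> a \<in> S \<and> (\<forall>x\<in>S. x \<noteq> a \<longrightarrow> g a < g x)"

definition strict_local_min_on :: "'a::topological_space set \<Rightarrow> ('a \<Rightarrow> real) \<Rightarrow> 'a \<Rightarrow> bool"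
  where "strict_local_min_on S g a \<longleftrightarrow> (\<exists>W. neighborhood a W \<and> strict_min_on (S \<inter> W) g a)"

end

theory Submission
  imports Defs
begin

text \<open>By compactness the contact exceeds \<open>b\<close> by a positive constant \<open>c\<close> on the unit sphere around
  \<open>\<omega>\<close>; by homogeneity it then exceeds \<open>b\<close> by \<open>c * dist x \<omega>\<close> everywhere. Near \<open>\<omega>\<close>, tangency lets
  \<open>f\<close> deviate from its contact by at most half of that.\<close>

lemma (in contracting_space) homogeneous_real_center:
  assumes "homogeneous star (real_star b) h"
  shows "h \<omega> = b"
proof -
  have "h (star 0 \<omega>) = real_star b 0 (h \<omega>)"
    using assms unfolding homogeneous_def by blast
  then show ?thesis
    by (simp add: star_center real_star_def)
qed

text \<open>A linear lower bound is the form of strict minimality that survives an error of size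
  o(\<open>dist x \<omega>\<close>), which is all that tangency controls.\<close>

lemma (in contracting_space) homogeneous_linear_growth:
  assumes hom: "homogeneous star (real_star b) h"
    and cont: "continuous_on (sphere \<omega> 1) h"
    and comp: "compact (sphere \<omega> 1)"
    and min: "strict_min_on UNIV h \<omega>"
  shows "\<exists>c>0. \<forall>x. b + c * dist x \<omega> \<le> h x"
proof -
  have h\<omega>: "h \<omega> = b"
    by (rule homogeneous_real_center[OF hom])
  have gt: "b < h x" if "x \<noteq> \<omega>" for x
    using min that h\<omega> by (simp add: strict_min_on_def)
  obtain c where c: "c > 0" "\<And>y. y \<in> sphere \<omega> 1 \<Longrightarrow> b + c \<le> h y"
  proof (cases "sphere \<omega> 1 = {}")
    \<comment> \<open>The sphere is empty when the space is just \<open>\<omega>\<close>; any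
      positive constant then serves.\<close>
    case True
    then show ?thesis
      using that[of 1] by simp
  next
    case False
    obtain z where z: "z \<in> sphere \<omega> 1" "\<And>y. y \<in> sphere \<omega> 1 \<Longrightarrow> h z \<le> h y"
      using continuous_attains_inf[OF comp False cont] by blast
    have "z \<noteq> \<omega>"
      using z(1) by auto
    \<comment> \<open>The constant is the gap at the minimiser \<open>z\<close>, positive because
      \<open>z\<close> lies at distance 1 from \<open>\<omega>\<close>.\<close>
    then show ?thesis
      using that[of "h z - b"] gt z(2) by simp
  qed
  have "b + c * dist x \<omega> \<le> h x" for x
  proof (cases "x = \<omega>")
    case True
    then show ?thesis
      by (simp add: h\<omega>)
  next
    case False
    define r where "r = dist x \<omega>"
    have r: "r > 0"
      using False by (simp add: r_def)
    \<comment> \<open>\<open>y\<close> is the radial projection of \<open>x\<close> to the unit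
      sphere; scaling by \<open>r\<close> undoes it and carries the bound at \<open>y\<close> back
      to \<open>x\<close>.\<close>
    define y where "y = star (1 / r) x"
    have "dist y \<omega> = 1"
      using r by (simp add: y_def dist_star_omega flip: r_def)
    then have "b + c \<le> h y"
      using c(2) by (simp add: dist_commute)
    then have "r * c \<le> r * (h y - b)"
      using r by simp
    moreover have "x = star r y"
      using r by (simp add: y_def star_assoc star_one)
    then have "h x = b + r * (h y - b)"
      using hom r by (simp add: homogeneous_def real_star_def)
    ultimately show ?thesis
      by (simp add: r_def mult.commute)
  qed
  with c(1) show ?thesis
    by blast
qed

text \<open>Close to \<open>\<omega>\<close>, f x \<ge> h x - (c/2) d \<ge> f \<omega> + (c/2) d
  with d = \<open>dist x \<omega>\<close>, and this exceeds f \<omega> once x differs from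
  \<omega>.\<close>

lemma tangent_at_linear_growth_strict_local_min:
  fixes f h :: "'a::metric_space \<Rightarrow> real"
  assumes "\<omega> \<in> U" and tan: "tangent_at \<omega> U f h"
    and "c > 0" and growth: "\<And>x. f \<omega> + c * dist x \<omega> \<le> h x"
  shows "strict_local_min_on U f \<omega>"
proof -
  \<comment> \<open>Tangency is used with \<epsilon> = \<open>c / 2\<close>, so half of the growth
    of \<open>h\<close> is left over.\<close>
  obtain \<eta> where \<eta>: "\<eta> > 0"
      "\<And>x. x \<in> U \<Longrightarrow> dist x \<omega> \<le> \<eta> \<Longrightarrow> dist (f x) (h x) \<le> c / 2 * dist x \<omega>"
    using tan half_gt_zero[OF \<open>c > 0\<close>] unfolding tangent_at_def by blast
  have "f \<omega> < f x" if "x \<in> U" "x \<in> ball \<omega> \<eta>" "x \<noteq> \<omega>" for x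
  proof -
    have "0 < c / 2 * dist x \<omega>"
      using \<open>c > 0\<close> that(3) by simp
    moreover have "\<bar>f x - h x\<bar> \<le> c / 2 * dist x \<omega>"
      using \<eta>(2)[OF that(1)] that(2) by (simp add: dist_commute dist_real_def)
    ultimately show ?thesis
      using growth[of x] by linarith
  qed
  then have "strict_min_on (U \<inter> ball \<omega> \<eta>) f \<omega>"
    using \<open>\<omega> \<in> U\<close> \<eta>(1) by (auto simp: strict_min_on_def)
  moreover have "neighborhood \<omega> (ball \<omega> \<eta>)"
    using \<eta>(1) unfolding neighborhood_def by (intro exI[of _ "ball \<omega> \<eta>"]) simp
  ultimately show ?thesis
    unfolding strict_local_min_on_def by blast
qed

theorem theorem2p6p4:
  fixes star :: "real \<Rightarrow> 'a::metric_space \<Rightarrow> 'a" and \<omega> :: 'a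
    and U :: "'a set" and b :: real and f :: "'a \<Rightarrow> real"
  assumes "contracting_space star \<omega>"
    and "neighborhood \<omega> U"
    and "centred_map \<omega> U b UNIV f"
    and "contactable star \<omega> U (real_star b) f"
    and "\<And>S :: 'a set. closed S \<Longrightarrow> bounded S \<Longrightarrow> compact S"
    and "strict_min_on UNIV (contact star \<omega> U (real_star b) f) \<omega>"
  shows "strict_local_min_on U f \<omega>"
proof -
  interpret contracting_space star \<omega> by fact
  let ?h = "contact star \<omega> U (real_star b) f"
  \<comment> \<open>Uniqueness of contacts gives the description operator in \<open>?h\<close> its
    defining property.\<close>
  have contact: "is_contact star \<omega> U (real_star b) f ?h"
    by (rule is_contact_contact[OF assms(1) contracting_space_real assms(2,4)])
  have hom: "homogeneous star (real_star b) ?h" and tan: "tangent_at \<omega> U f ?h"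
    using contact by (simp_all add: is_contact_def)
  obtain C where "C-lipschitz_on UNIV ?h"
    using contact by (auto simp: is_contact_def)
  \<comment> \<open>The Lipschitz bound enters through continuity, which lets \<open>?h\<close>
    attain its infimum on the sphere.\<close>
  then have cont: "continuous_on (sphere \<omega> 1) ?h"
    by (rule continuous_on_subset[OF lipschitz_on_continuous_on subset_UNIV])
  have "bounded (sphere \<omega> 1)"
    by (rule bounded_subset[OF bounded_cball sphere_cball])
  moreover have "closed (sphere \<omega> 1)"
    unfolding sphere_def by (intro closed_Collect_eq continuous_intros)
  ultimately have "compact (sphere \<omega> 1)"
    by (intro assms(5))
  from homogeneous_linear_growth[OF hom cont this assms(6)]
  obtain c where c: "c > 0" "\<forall>x. b + c * dist x \<omega> \<le> ?h x"
    by blast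
  have "\<omega> \<in> U"
    using assms(2) by (auto simp: neighborhood_def)
  \<comment> \<open>This turns the base value \<open>b\<close> of the growth bound into
    \<open>f \<omega>\<close>.\<close>
  moreover have "f \<omega> = b"
    using assms(3) by (simp add: centred_map_def)
  ultimately show ?thesis
    using tangent_at_linear_growth_strict_local_min[OF _ tan c(1)] c(2) by simp
qed

end
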